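(* Let $N\ge 2$. The simple-root-type and higher-root-type expressions of the left and right blocks coincide as linear operators on formal power series in $x_1,\dots,x_N$: $$\mathcal{A}_L^{(\mathrm s)}=\mathcal{A}_L^{(\mathrm h)},\qquad \mathcal{A}_R^{(\mathrm s)}=\mathcal{A}_R^{(\mathrm h)}.$$ Here $$\mathcal{A}_L^{(\mathrm s)}=\frac{1}{G_L}\,\frac{1}{\varphi(-\check x_0)}\,G_L\,\frac{1}{\varphi(-\check x_{N-1})}\cdots\frac{1}{\varphi(-\check x_2)}\frac{1}{\varphi(-\check x_1)}\,\varphi(\Lambda),$$ $$\mathcal{A}_R^{(\mathrm s)}=\varphi(q^{1-N}D_N\Lambda)\,\frac{1}{\varphi(-\hat x_1)}\frac{1}{\varphi(-\hat x_2)}\cdots\frac{1}{\varphi(-\hat x_{N-1})}\,G_R\,\frac{1}{\varphi(-\hat x_0)}\,\frac{1}{G_R},$$ with $G_L=\varphi(-\check x_1)\varphi(-\check x_2)\cdots\varphi(-\check x_{N-2})$ and $G_R=\varphi(-\hat x_{N-2})\cdots\varphi(-\hat x_2)\varphi(-\hat x_1)$ (both equal to $1$ if $N=2$), and $$\mathcal{A}_L^{(\mathrm h)}=e_q(-\check x_0)\,e_q(-\check x_0\check x_1)\cdots e_q(-\check x_0\check x_1\cdots\check x_{N-2})\cdot e_q(-\check x_{N-1})\cdots e_q(-\check x_1)\cdot\varphi(\Lambda),$$ $$\mathcal{A}_R^{(\mathrm h)}=\varphi(q^{1-N}D_N\Lambda)\cdot e_q(-\hat x_1)\cdots e_q(-\hat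 x_{N-1})\cdot e_q(-\hat x_{N-2}\cdots\hat x_1\hat x_0)\cdots e_q(-\hat x_1\hat x_0)\,e_q(-\hat x_0).$$
   Context: Let $0<|q|<1$. Indices $i$ are in $\mathbb{Z}/N\mathbb{Z}$ (so $x_0=x_N$, etc.), $x_1,\dots,x_N$ are commuting variables, $\vartheta_i=x_i\frac{\partial}{\partial x_i}$, so $q^{\vartheta_i}$ is the operator $x_i\mapsto qx_i$. Let $d_i,\overline d_i$ be nonzero complex parameters, $D_N=\prod_{k=1}^N d_k\overline d_k$, $\Lambda=x_1x_2\cdots x_N$, and define operators on formal power series in $x_1,\dots,x_N$: $$\hat x_i=d_i\overline d_i\,x_i\,q^{\vartheta_i-\vartheta_{i-1}},\qquad \check x_i=x_i\,q^{-\vartheta_i+\vartheta_{i-1}}.$$ Further $\varphi(z)=(z;q)_\infty=\prod_{n\ge0}(1-zq^n)=\sum_{n\ge 0}\frac{q^{n(n-1)/2}(-z)^n}{(q;q)_n}$ and $e_q(z)=\varphi(z)^{-1}=\sum_{n\ge0}\frac{z^n}{(q;q)_n}$, with $(q;q)_n=\prod_{k=1}^n(1-q^k)$; with operator arguments these are understood through their power series. *)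

theory Defs
  imports Complex_Main
begin

text \<open>
  A formal power series is given by its coefficients. The index set of the variables is
  \<open>\<int>/N\<int>\<close>, represented by \<open>{0..<N}\<close> (so \<open>x\<^sub>N\<close> is \<open>x\<^sub>0\<close>), and a monomial is an exponent
  function \<open>nat \<Rightarrow> nat\<close> supported there.
\<close>

type_synonym mseries = "(nat \<Rightarrow> nat) \<Rightarrow> complex"

type_synonym mop = "mseries \<Rightarrow> mseries"

definition power_series :: "nat \<Rightarrow> mseries set" where
  "power_series N = {f. \<forall>m. f m \<noteq> 0 \<longrightarrow> (\<forall>i\<ge>N. m i = 0)}"

definition mult_var :: "nat \<Rightarrow> nat \<Rightarrow> mop" where
  "mult_var N i f = (\<lambda>m. let j = i mod N in if m j = 0 then 0 else f (m(j := m j - 1)))"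

text \<open>
  The substitution \<open>x\<^sub>i \<mapsto> a x\<^sub>i\<close>. Thus \<open>q\<close> to the power \<open>\<plusminus>\<vartheta>\<^sub>i\<close> is obtained for
  \<open>a = q\<close> and \<open>a = inverse q\<close>, respectively.
\<close>

definition scale_var :: "nat \<Rightarrow> complex \<Rightarrow> nat \<Rightarrow> mop" where
  "scale_var N a i f = (\<lambda>m. a ^ m (i mod N) * f m)"

definition op_scale :: "complex \<Rightarrow> mop \<Rightarrow> mop" where
  "op_scale c A f = (\<lambda>m. c * A f m)"

definition op_prod :: "mop list \<Rightarrow> mop" where
  "op_prod As = foldr (\<circ>) As id"

definition op_inverse :: "nat \<Rightarrow> mop \<Rightarrow> mop" where
  "op_inverse N A = inv_into (power_series N) A"

text \<open>
  The formal power series \<open>\<Sum>n. c n * z ^ n\<close> at an operator argument, taken coefficientwise.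
  All arguments used below strictly raise the total degree, so that only finitely many terms
  contribute to each coefficient and the \<open>suminf\<close> is a finite sum.
\<close>

definition op_series :: "(nat \<Rightarrow> complex) \<Rightarrow> mop \<Rightarrow> mop" where
  "op_series c A f = (\<lambda>m. \<Sum>n. c n * (A ^^ n) f m)"

definition qfact :: "complex \<Rightarrow> nat \<Rightarrow> complex" where
  "qfact q n = (\<Prod>k=1..n. 1 - q ^ k)"

definition phi :: "complex \<Rightarrow> mop \<Rightarrow> mop" where
  "phi q = op_series (\<lambda>n. q ^ (n * (n - 1) div 2) * (- 1) ^ n / qfact q n)"

definition e_q :: "complex \<Rightarrow> mop \<Rightarrow> mop" where
  "e_q q = op_series (\<lambda>n. 1 / qfact q n)"

text \<open>The index \<open>i + N - 1\<close> stands for \<open>i - 1\<close> modulo \<open>N\<close>.\<close>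

definition x_hat ::
  "nat \<Rightarrow> complex \<Rightarrow> (nat \<Rightarrow> complex) \<Rightarrow> (nat \<Rightarrow> complex) \<Rightarrow> nat \<Rightarrow> mop" where
  "x_hat N q d d' i =
     op_scale (d (i mod N) * d' (i mod N))
       (mult_var N i \<circ> scale_var N q i \<circ> scale_var N (inverse q) (i + N - 1))"

definition x_check :: "nat \<Rightarrow> complex \<Rightarrow> nat \<Rightarrow> mop" where
  "x_check N q i = mult_var N i \<circ> scale_var N (inverse q) i \<circ> scale_var N q (i + N - 1)"

definition Lam :: "nat \<Rightarrow> mop" where
  "Lam N = op_prod (map (mult_var N) [1..<N + 1])"

definition D_prod :: "nat \<Rightarrow> (nat \<Rightarrow> complex) \<Rightarrow> (nat \<Rightarrow> complex) \<Rightarrow> complex" where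
  "D_prod N d d' = (\<Prod>k=1..N. d (k mod N) * d' (k mod N))"

definition G_L :: "nat \<Rightarrow> complex \<Rightarrow> mop" where
  "G_L N q = op_prod (map (\<lambda>i. phi q (op_scale (- 1) (x_check N q i))) [1..<N - 1])"

definition G_R ::
  "nat \<Rightarrow> complex \<Rightarrow> (nat \<Rightarrow> complex) \<Rightarrow> (nat \<Rightarrow> complex) \<Rightarrow> mop" where
  "G_R N q d d' =
     op_prod (map (\<lambda>i. phi q (op_scale (- 1) (x_hat N q d d' i))) (rev [1..<N - 1]))"

definition A_L_simple :: "nat \<Rightarrow> complex \<Rightarrow> mop" where
  "A_L_simple N q =
     op_inverse N (G_L N q)
     \<circ> op_inverse N (phi q (op_scale (- 1) (x_check N q 0)))
     \<circ> G_L N q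
     \<circ> op_prod (map (\<lambda>i. op_inverse N (phi q (op_scale (- 1) (x_check N q i)))) (rev [1..<N]))
     \<circ> phi q (Lam N)"

definition A_R_simple ::
  "nat \<Rightarrow> complex \<Rightarrow> (nat \<Rightarrow> complex) \<Rightarrow> (nat \<Rightarrow> complex) \<Rightarrow> mop" where
  "A_R_simple N q d d' =
     phi q (op_scale (q powi (1 - int N) * D_prod N d d') (Lam N))
     \<circ> op_prod (map (\<lambda>i. op_inverse N (phi q (op_scale (- 1) (x_hat N q d d' i)))) [1..<N])
     \<circ> G_R N q d d'
     \<circ> op_inverse N (phi q (op_scale (- 1) (x_hat N q d d' 0)))
     \<circ> op_inverse N (G_R N q d d')"

definition A_L_higher :: "nat \<Rightarrow> complex \<Rightarrow> mop" where
  "A_L_higher N q =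
     op_prod (map (\<lambda>k. e_q q (op_scale (- 1) (op_prod (map (x_check N q) [0..<k + 1]))))
       [0..<N - 1])
     \<circ> op_prod (map (\<lambda>i. e_q q (op_scale (- 1) (x_check N q i))) (rev [1..<N]))
     \<circ> phi q (Lam N)"

definition A_R_higher ::
  "nat \<Rightarrow> complex \<Rightarrow> (nat \<Rightarrow> complex) \<Rightarrow> (nat \<Rightarrow> complex) \<Rightarrow> mop" where
  "A_R_higher N q d d' =
     phi q (op_scale (q powi (1 - int N) * D_prod N d d') (Lam N))
     \<circ> op_prod (map (\<lambda>i. e_q q (op_scale (- 1) (x_hat N q d d' i))) [1..<N])
     \<circ> op_prod (map (\<lambda>k. e_q q (op_scale (- 1) (op_prod (map (x_hat N q d d') (rev [0..<k + 1])))))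
         (rev [0..<N - 1]))"

end

(*
  All the operators involved strictly raise the total degree, so coefficientwise the power series
  in them are finite sums. Everything reduces to the q-exponential pentagon identity
    e_q(Y) e_q(X) = e_q(X) e_q(-XY) e_q(Y)   whenever   YX = q XY,
  which, after moving all X to the left of all Y, is Cauchy's q-binomial theorem at z = q^m;
  the case z = 0 of the same theorem gives 1/phi = e_q. Of the neighbours of index k only k - 1
  occurs among 0, ..., k - 1 as long as k < N - 1, so conjugating by the k-th factor of G commutes
  past all factors but the last and splits that one into two.
*)
theory Submission
  imports Defs
begin

text \<open>Two obstacles shape the proof. \<open>op_inverse\<close> is an \<open>inv_into\<close>
  over \<open>power_series N\<close>, so its values are under control only on that set, whereas the
  pentagon and the conjugation identities are equalities of operators on all functions. The latter
  are therefore proved with \<open>e_q\<close> in place of inverses, and each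
  \<open>op_inverse\<close> is traded for \<open>e_q\<close> only at the very end, at a concrete
  argument whose membership in \<open>power_series N\<close> has been tracked. The other obstacle is
  the cyclic index: 0 is a neighbour of \<open>N - 1\<close> as well as of 1. The conjugation takes
  place on the open chain 0, ..., \<open>N - 2\<close>, where this closing relation is invisible.
  The product of the factors with indices 1, ..., \<open>N - 1\<close> and the factor
  \<open>phi\<close> in Lambda are common to both forms and are never rearranged.\<close>

lemma op_scale_op_scale: "op_scale c (op_scale b A) = op_scale (c * b) A"
  by (simp add: op_scale_def mult.assoc fun_eq_iff)

lemma op_scale_1: "op_scale 1 A = A"
  by (simp add: op_scale_def fun_eq_iff)

lemma op_scale_comp: "op_scale c A \<circ> B = op_scale c (A \<circ> B)"
  by (simp add: op_scale_def fun_eq_iff)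

lemma op_prod_Nil [simp]: "op_prod [] = id"
  and op_prod_Cons [simp]: "op_prod (A # As) = A \<circ> op_prod As"
  by (simp_all add: op_prod_def)

lemma op_prod_append: "op_prod (As @ Bs) = op_prod As \<circ> op_prod Bs"
  by (induction As) (auto simp: comp_assoc)

section \<open>The degree filtration and the operators that respect it\<close>

definition total_degree :: "nat \<Rightarrow> (nat \<Rightarrow> nat) \<Rightarrow> nat" where
  "total_degree N m = (\<Sum>i<N. m i)"

text \<open>This is the order filtration with the variables beyond \<open>N\<close> ignored, so it
  makes sense for arbitrary functions of the exponents. Shift 1 makes operator series locally
  finite; shift 0 is the continuity needed to apply an operator to such a series term by term.
  Stability of \<open>power_series N\<close> is bundled in for the sake of
  \<open>op_inverse\<close>.\<close>

definition degree_raising :: "nat \<Rightarrow> nat \<Rightarrow> mop \<Rightarrow> bool" where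
  "degree_raising N k A \<longleftrightarrow>
     (\<forall>f g. A (\<lambda>m. f m + g m) = (\<lambda>m. A f m + A g m)) \<and>
     (\<forall>c f. A (\<lambda>m. c * f m) = (\<lambda>m. c * A f m)) \<and>
     (\<forall>f\<in>power_series N. A f \<in> power_series N) \<and>
     (\<forall>f n. (\<forall>m. total_degree N m < n \<longrightarrow> f m = 0) \<longrightarrow>
        (\<forall>m. total_degree N m < n + k \<longrightarrow> A f m = 0))"

lemma degree_raising_add:
  "degree_raising N k A \<Longrightarrow> A (\<lambda>m. f m + g m) = (\<lambda>m. A f m + A g m)"
  and degree_raising_scale:
  "degree_raising N k A \<Longrightarrow> A (\<lambda>m. c * f m) = (\<lambda>m. c * A f m)"
  and degree_raising_power_series:
  "degree_raising N k A \<Longrightarrow> f \<in> power_series N \<Longrightarrow> A f \<in> power_series N"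
  by (auto simp: degree_raising_def)

lemma degree_raising_vanish:
  assumes "degree_raising N k A" "\<And>m. total_degree N m < n \<Longrightarrow> f m = 0"
    and "total_degree N m < n + k"
  shows "A f m = 0"
  using assms unfolding degree_raising_def by blast

lemma degree_raising_sum:
  assumes "degree_raising N k A"
  shows "A (\<lambda>m. \<Sum>n\<in>S. c n * g n m) = (\<lambda>m. \<Sum>n\<in>S. c n * A (g n) m)"
proof -
  have "A (\<lambda>m. 0) = (\<lambda>m. 0)"
    using degree_raising_scale[OF assms, of 0 "\<lambda>_. 0"] by simp
  then show ?thesis
    by (induction S rule: infinite_finite_induct)
      (simp_all add: degree_raising_add[OF assms] degree_raising_scale[OF assms])
qed

lemma degree_raising_mono: "degree_raising N k A \<Longrightarrow> l \<le> k \<Longrightarrow> degree_raising N l A"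
  unfolding degree_raising_def by (meson add_left_mono order_less_le_trans)

lemma degree_raising_comp:
  assumes A: "degree_raising N k A" and B: "degree_raising N l B"
  shows "degree_raising N (k + l) (A \<circ> B)"
  unfolding degree_raising_def
proof (intro conjI allI impI ballI)
  fix f :: mseries and n m assume f: "\<forall>m. total_degree N m < n \<longrightarrow> f m = 0"
    and m: "total_degree N m < n + (k + l)"
  show "(A \<circ> B) f m = 0"
    unfolding o_def
    by (rule degree_raising_vanish[OF A, of "n + l"])
      (use f m degree_raising_vanish[OF B, of n f] in auto)
qed (auto simp: degree_raising_add[OF A] degree_raising_add[OF B] degree_raising_scale[OF A]
       degree_raising_scale[OF B] degree_raising_power_series[OF A]
       degree_raising_power_series[OF B])

lemma degree_raising_id: "degree_raising N 0 id"
  by (auto simp: degree_raising_def)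

lemma degree_raising_funpow:
  assumes "degree_raising N k A"
  shows "degree_raising N (n * k) (A ^^ n)"
  by (induction n) (use assms in \<open>auto intro!: degree_raising_comp degree_raising_id[unfolded id_def]
      simp: degree_raising_id simp del: o_apply\<close>)

lemma degree_raising_op_scale:
  assumes A: "degree_raising N k A"
  shows "degree_raising N k (op_scale c A)"
  unfolding degree_raising_def
proof (intro conjI allI impI ballI)
  fix f :: mseries and n m assume "\<forall>m. total_degree N m < n \<longrightarrow> f m = 0" "total_degree N m < n + k"
  then show "op_scale c A f m = 0"
    using degree_raising_vanish[OF A, of n f m] by (simp add: op_scale_def)
next
  fix f assume "f \<in> power_series N"
  then show "op_scale c A f \<in> power_series N"
    using degree_raising_power_series[OF A, of f] by (auto simp: op_scale_def power_series_def)
qed (auto simp: op_scale_def degree_raising_add[OF A] degree_raising_scale[OF A] algebra_simps)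

lemma comp_op_scale:
  "degree_raising N k A \<Longrightarrow> A \<circ> op_scale c B = op_scale c (A \<circ> B)"
  by (simp add: op_scale_def fun_eq_iff degree_raising_scale)

lemma degree_raising_op_prod:
  "(\<And>A. A \<in> set As \<Longrightarrow> degree_raising N 0 A) \<Longrightarrow> degree_raising N 0 (op_prod As)"
  by (induction As) (auto intro: degree_raising_id degree_raising_comp[of _ 0 _ 0, simplified])

lemma degree_raising_op_prod_nonempty:
  assumes "\<And>A. A \<in> set As \<Longrightarrow> degree_raising N 1 A" "As \<noteq> []"
  shows "degree_raising N 1 (op_prod As)"
proof (cases As)
  case (Cons A Bs)
  have "degree_raising N (1 + 0) (A \<circ> op_prod Bs)"
    by (rule degree_raising_comp)
      (use assms(1) Cons in \<open>auto intro!: degree_raising_op_prod intro: degree_raising_mono[of _ 1]\<close>)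
  then show ?thesis using Cons by simp
qed (use assms in simp)

lemma degree_raising_funpow_vanish:
  assumes "degree_raising N 1 A" "total_degree N m < n"
  shows "(A ^^ n) f m = 0"
  using degree_raising_vanish[OF degree_raising_funpow[OF assms(1)], of 0 f m n] assms(2) by simp

section \<open>Power series in an operator of positive degree\<close>

lemma op_series_eq_sum:
  assumes "degree_raising N 1 A" "total_degree N m \<le> K"
  shows "op_series c A f m = (\<Sum>n\<le>K. c n * (A ^^ n) f m)"
  unfolding op_series_def
  by (rule suminf_finite) (use assms in \<open>auto intro: degree_raising_funpow_vanish\<close>)

text \<open>The shift drops to 0 because the constant term contributes \<open>c 0\<close> times the
  identity.\<close>

lemma degree_raising_op_series:
  assumes A: "degree_raising N 1 A"
  shows "degree_raising N 0 (op_series c A)"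
  unfolding degree_raising_def
proof (intro conjI allI impI ballI ext)
  note An = degree_raising_funpow[OF A]
  fix f g b m
  show "op_series c A (\<lambda>m. f m + g m) m = op_series c A f m + op_series c A g m"
    by (simp add: op_series_eq_sum[OF A order_refl] degree_raising_add[OF An] sum.distrib
        algebra_simps)
  show "op_series c A (\<lambda>m. b * f m) m = b * op_series c A f m"
    by (simp add: op_series_eq_sum[OF A order_refl] degree_raising_scale[OF An]
        sum_distrib_left algebra_simps)
next
  note An = degree_raising_funpow[OF A]
  fix f :: mseries and n m assume f: "\<forall>m. total_degree N m < n \<longrightarrow> f m = 0" "total_degree N m < n + 0"
  then have "(A ^^ j) f m = 0" for j
    by (intro degree_raising_vanish[OF An, of n]) auto
  then show "op_series c A f m = 0"
    by (simp add: op_series_def)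
next
  note An = degree_raising_funpow[OF A]
  fix f assume "f \<in> power_series N"
  then have "\<forall>m. (A ^^ j) f m \<noteq> 0 \<longrightarrow> (\<forall>i\<ge>N. m i = 0)" for j
    using degree_raising_power_series[OF An] by (simp add: power_series_def)
  then have "(A ^^ j) f m = 0" if "i \<ge> N" "m i \<noteq> 0" for i j m
    using that by metis
  then show "op_series c A f \<in> power_series N"
    unfolding power_series_def op_series_def by (auto intro: ccontr)
qed

lemma degree_raising_e_q: "degree_raising N 1 A \<Longrightarrow> degree_raising N 0 (e_q q A)"
  and degree_raising_phi: "degree_raising N 1 A \<Longrightarrow> degree_raising N 0 (phi q A)"
  by (simp_all add: e_q_def phi_def degree_raising_op_series)

text \<open>The remainder of the truncated series vanishes up to degree \<open>K\<close>, and so does its image.\<close>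

lemma degree_raising_apply_op_series:
  assumes T: "degree_raising N 0 T" and A: "degree_raising N 1 A" and m: "total_degree N m \<le> K"
  shows "T (op_series c A f) m = (\<Sum>n\<le>K. c n * T ((A ^^ n) f) m)"
proof -
  let ?S = "\<lambda>m. \<Sum>n\<le>K. c n * (A ^^ n) f m"
  let ?R = "\<lambda>m. op_series c A f m + (- 1) * ?S m"
  have "T ?R m = 0"
    by (rule degree_raising_vanish[OF T, of "Suc K"])
      (use m op_series_eq_sum[OF A, of _ K c f] in auto)
  then show ?thesis
    unfolding degree_raising_add[OF T] degree_raising_scale[OF T] degree_raising_sum[OF T]
    by simp
qed

lemma comp_funpow_commute: "A \<circ> B = B \<circ> A \<Longrightarrow> A \<circ> (B ^^ n) = (B ^^ n) \<circ> A"
  by (induction n) (auto simp: fun_eq_iff)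

lemma op_series_commute:
  assumes T: "degree_raising N 0 T" and A: "degree_raising N 1 A" and TA: "T \<circ> A = A \<circ> T"
  shows "T \<circ> op_series c A = op_series c A \<circ> T"
proof (intro ext)
  fix f m
  have "T ((A ^^ n) f) = (A ^^ n) (T f)" for n
    using comp_funpow_commute[OF TA, of n] by (simp add: fun_eq_iff)
  then show "(T \<circ> op_series c A) f m = (op_series c A \<circ> T) f m"
    using degree_raising_apply_op_series[OF T A order_refl, of c f m]
    by (simp add: op_series_eq_sum[OF A order_refl])
qed

text \<open>The commutation is lifted one series at a time: first \<open>B\<close> past
  \<open>e_q q A\<close>, then \<open>e_q q A\<close> past the series in \<open>B\<close>.\<close>

lemma e_q_commute:
  assumes A: "degree_raising N 1 A" and B: "degree_raising N 1 B" and AB: "A \<circ> B = B \<circ> A"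
  shows "e_q q A \<circ> e_q q B = e_q q B \<circ> e_q q A"
proof -
  have "B \<circ> e_q q A = e_q q A \<circ> B"
    unfolding e_q_def
    by (rule op_series_commute[OF degree_raising_mono[OF B] A AB[symmetric]]) simp
  then have "e_q q A \<circ> op_series c B = op_series c B \<circ> e_q q A" for c
    by (intro op_series_commute[OF degree_raising_e_q[OF A] B]) simp
  then show ?thesis
    unfolding e_q_def by blast
qed

lemma op_prod_commute:
  "(\<And>B. B \<in> set Bs \<Longrightarrow> A \<circ> B = B \<circ> A) \<Longrightarrow> A \<circ> op_prod Bs = op_prod Bs \<circ> A"
proof (induction Bs)
  case (Cons B Bs)
  have AB: "A \<circ> B = B \<circ> A"
    by (rule Cons.prems) simp
  have ABs: "A \<circ> op_prod Bs = op_prod Bs \<circ> A"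
    by (rule Cons.IH, rule Cons.prems) simp
  have "A \<circ> op_prod (B # Bs) = (A \<circ> B) \<circ> op_prod Bs"
    by (simp only: op_prod_Cons comp_assoc)
  also have "\<dots> = op_prod (B # Bs) \<circ> A"
    unfolding AB by (simp only: op_prod_Cons comp_assoc ABs)
  finally show ?case .
qed simp

text \<open>Meant for \<open>G n = (A ^^ n) f m\<close>, which vanishes beyond the degree of
  \<open>m\<close>: products of truncated series can be reindexed by the total exponent while every
  index keeps the range up to \<open>K\<close>, so the sums can still be swapped.\<close>

lemma sum_atMost_shift:
  fixes h G :: "nat \<Rightarrow> complex"
  assumes "\<And>n. n > K \<Longrightarrow> G n = 0"
  shows "(\<Sum>i\<le>K. h i * G (i + j)) = (\<Sum>n\<le>K. if j \<le> n then h (n - j) * G n else 0)"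
proof -
  have "(\<Sum>n\<le>K. if j \<le> n then h (n - j) * G n else 0) = (\<Sum>n\<in>{j..K}. h (n - j) * G n)"
    by (rule sum.mono_neutral_cong_right) auto
  also have "\<dots> = (\<Sum>n\<in>{j..K + j}. h (n - j) * G n)"
    by (rule sum.mono_neutral_left) (auto simp: assms)
  also have "\<dots> = (\<Sum>i\<le>K. h i * G (i + j))"
    by (rule sum.reindex_bij_witness[of _ "\<lambda>i. i + j" "\<lambda>n. n - j"]) auto
  finally show ?thesis by simp
qed

section \<open>q-factorials and Cauchy's q-binomial theorem\<close>

lemma qfact_Suc: "qfact q (Suc n) = qfact q n * (1 - q ^ Suc n)"
  by (simp add: qfact_def)

lemma qfact_0 [simp]: "qfact q 0 = 1"
  by (simp add: qfact_def)

lemma one_minus_power_nonzero: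
  fixes q :: complex
  assumes "norm q < 1"
  shows "1 - q ^ Suc n \<noteq> 0"
proof
  assume "1 - q ^ Suc n = 0"
  then have "norm q ^ Suc n = 1"
    by (metis eq_iff_diff_eq_0 norm_one norm_power)
  moreover have "norm q ^ Suc n < 1"
    by (cases "q = 0") (use assms in \<open>auto intro!: power_Suc_less_one simp del: power_Suc\<close>)
  ultimately show False by simp
qed

lemma qfact_nonzero: "norm q < 1 \<Longrightarrow> qfact q n \<noteq> 0"
  using one_minus_power_nonzero[of q]
  by (induction n) (simp_all add: qfact_Suc del: power_Suc)

text \<open>The Gaussian binomial coefficient. The value 0 beyond \<open>n\<close> makes the Pascal
  rule hold at the edge and lets sums be lengthened by a zero term.\<close>

definition qbinom :: "complex \<Rightarrow> nat \<Rightarrow> nat \<Rightarrow> complex" where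
  "qbinom q n j = (if j \<le> n then qfact q n / (qfact q j * qfact q (n - j)) else 0)"

lemma qbinom_Suc_Suc:
  assumes "norm q < 1"
  shows "qbinom q (Suc n) (Suc j) = qbinom q n j + q ^ Suc j * qbinom q n (Suc j)"
proof -
  note nz = qfact_nonzero[OF assms] one_minus_power_nonzero[OF assms]
  consider "j > n" | "j = n" | "j < n" by linarith
  then show ?thesis
  proof cases
    case 3
    then obtain d where n: "n = Suc (j + d)"
      using less_natE by blast
    define a b where "a = q ^ Suc j" and "b = q ^ Suc d"
    have "q ^ Suc n = a * b"
      by (simp add: n a_def b_def power_add)
    moreover have "1 - a \<noteq> 0" "1 - b \<noteq> 0"
      unfolding a_def b_def using nz(2) by auto
    \<comment> \<open>Cleared of denominators this is
      \<open>1 - a * b = (1 - a) + a * (1 - b)\<close>.\<close>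
    moreover have "Q * (1 - a * b) / (A * (1 - a) * (B * (1 - b)))
        = Q / (A * (B * (1 - b))) + a * (Q / (A * (1 - a) * B))"
      if "1 - a \<noteq> 0" "1 - b \<noteq> 0" "A \<noteq> 0" "B \<noteq> 0" for Q A B
      using that by (simp add: divide_simps) (simp add: algebra_simps)
    moreover have "n - j = Suc d" "n - Suc j = d" "j \<le> n" "Suc j \<le> n"
      by (auto simp: n)
    ultimately show ?thesis
      using nz(1)[of j] nz(1)[of d]
      by (simp add: qbinom_def qfact_Suc a_def[symmetric] b_def[symmetric] del: power_Suc)
  qed (use nz in \<open>auto simp: qbinom_def\<close>)
qed

lemma qbinom_0_right: "norm q < 1 \<Longrightarrow> qbinom q n 0 = 1"
  by (simp add: qbinom_def qfact_nonzero)

lemma q_Cauchy_binomial: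
  assumes q: "norm q < 1"
  shows "(\<Sum>j\<le>n. qbinom q n j * (\<Prod>i<j. z - q ^ i)) = z ^ n"
proof (induction n)
  case 0
  then show ?case by (simp add: qbinom_def)
next
  case (Suc n)
  let ?P = "\<lambda>j. \<Prod>i<j. z - q ^ i"
  have "z ^ Suc n = (\<Sum>j\<le>n. qbinom q n j * (z * ?P j))"
    by (simp add: Suc[symmetric] sum_distrib_left mult.left_commute)
  \<comment> \<open>Writing \<open>z = (z - q ^ j) + q ^ j\<close> either lengthens the product by
    one factor or keeps it with weight \<open>q ^ j\<close>; these become the two terms of the
    Pascal rule.\<close>
  also have "\<dots> = (\<Sum>j\<le>n. qbinom q n j * ?P (Suc j)) + (\<Sum>j\<le>n. q ^ j * qbinom q n j * ?P j)"
    by (simp add: sum.distrib[symmetric] algebra_simps)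
  \<comment> \<open>The added term \<open>j = Suc n\<close> is zero; it is there so that the index
    can be shifted by one.\<close>
  also have "(\<Sum>j\<le>n. q ^ j * qbinom q n j * ?P j) = (\<Sum>j\<le>Suc n. q ^ j * qbinom q n j * ?P j)"
    by (simp add: qbinom_def)
  also have "\<dots> = 1 + (\<Sum>j\<le>n. q ^ Suc j * qbinom q n (Suc j) * ?P (Suc j))"
    by (subst sum.atMost_Suc_shift) (simp add: qbinom_0_right[OF q])
  also have "(\<Sum>j\<le>n. qbinom q n j * ?P (Suc j)) + \<dots>
      = 1 + (\<Sum>j\<le>n. qbinom q (Suc n) (Suc j) * ?P (Suc j))"
    by (simp only: qbinom_Suc_Suc[OF q] distrib_right sum.distrib add_ac)
  also have "\<dots> = (\<Sum>j\<le>Suc n. qbinom q (Suc n) j * ?P j)"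
    by (subst sum.atMost_Suc_shift) (simp add: qbinom_0_right[OF q])
  finally show ?case by simp
qed

lemma power_choose_two_Suc:
  "q ^ (Suc j * (Suc j - 1) div 2) = q ^ (j * (j - 1) div 2) * (q::complex) ^ j"
proof (cases j)
  case (Suc i)
  have "Suc j * (Suc j - 1) = j * (j - 1) + j * 2"
    by (simp add: Suc)
  then have "Suc j * (Suc j - 1) div 2 = j * (j - 1) div 2 + j"
    by (metis div_mult_self1 zero_neq_numeral add.commute)
  then show ?thesis by (simp only: power_add)
qed simp

text \<open>The product in Cauchy's theorem at \<open>z = 0\<close>; up to division by
  \<open>qfact q j\<close> these are the coefficients of \<open>phi\<close>.\<close>

lemma prod_neg_power: "(\<Prod>i<j. - ((q::complex) ^ i)) = q ^ (j * (j - 1) div 2) * (- 1) ^ j"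
proof (induction j)
  case (Suc j)
  show ?case
    unfolding prod.lessThan_Suc Suc power_choose_two_Suc by simp
qed simp

text \<open>For \<open>j > m\<close> the factor \<open>i = m\<close> vanishes. Otherwise each factor
  is \<open>- (q ^ i) * (1 - q ^ (m - i))\<close>: the first parts give the sign and the power of
  \<open>q\<close>, the second parts a quotient of q-factorials.\<close>

lemma prod_power_diff:
  assumes q: "norm q < 1"
  shows "(\<Prod>i<j. q ^ m - q ^ i) =
    (if j \<le> m then (- 1) ^ j * q ^ (j * (j - 1) div 2) * (qfact q m / qfact q (m - j)) else 0)"
proof (induction j)
  case 0
  then show ?case using qfact_nonzero[OF q] by simp
next
  case (Suc j)
  consider "j > m" | "j = m" | "j < m" by linarith
  then show ?case
  proof cases
    case 3
    then obtain d where m: "m = j + Suc d"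
      using less_iff_Suc_add by auto
    have "q ^ m - q ^ j = - (q ^ j) * (1 - q ^ Suc d)"
      by (simp add: m power_add algebra_simps)
    moreover have "m - j = Suc d" "m - Suc j = d" "j \<le> m" "Suc j \<le> m"
      by (auto simp: m)
    ultimately show ?thesis
      using qfact_nonzero[OF q, of d] one_minus_power_nonzero[OF q, of d]
      by (simp only: prod.lessThan_Suc Suc if_True power_choose_two_Suc qfact_Suc
          power_Suc[of "- 1"]) (simp add: divide_simps del: power_Suc)
  qed (use Suc in auto)
qed

text \<open>The comparison of the coefficients of \<open>X^n Y^k\<close> in the pentagon, with
  \<open>j\<close> the exponent of the middle factor: Cauchy's theorem at \<open>z = q ^ k\<close>,
  divided by \<open>qfact q n * qfact q k\<close>. The limit \<open>K\<close> is a truncation degree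
  common to all sums.\<close>

lemma pentagon_coefficient:
  assumes q: "norm q < 1" and "n \<le> K"
  shows "(\<Sum>j\<le>K. if j \<le> n \<and> j \<le> k then (- 1) ^ j * q ^ (j * (j - 1) div 2) /
      (qfact q (n - j) * qfact q j * qfact q (k - j)) else 0) = q ^ (n * k) / (qfact q n * qfact q k)"
    (is "?L = _")
proof -
  have "q ^ (n * k) = (\<Sum>j\<le>n. qbinom q n j * (\<Prod>i<j. q ^ k - q ^ i))"
    by (simp add: q_Cauchy_binomial[OF q] power_mult[symmetric] mult.commute)
  also have "\<dots> = (\<Sum>j\<le>K. if j \<le> n then qbinom q n j * (\<Prod>i<j. q ^ k - q ^ i) else 0)"
    using assms(2) by (intro sum.mono_neutral_cong_left) auto
  also have "\<dots> = qfact q n * qfact q k * ?L"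
    unfolding sum_distrib_left prod_power_diff[OF q] qbinom_def
    by (rule sum.cong) (auto simp: field_simps)
  finally show ?thesis
    using qfact_nonzero[OF q] by simp
qed

lemma phi_e_q_coefficient:
  assumes q: "norm q < 1"
  shows "(\<Sum>j\<le>n. q ^ (j * (j - 1) div 2) * (- 1) ^ j / qfact q j * (1 / qfact q (n - j)))
    = (if n = 0 then 1 else 0)" (is "?L = _")
proof -
  have "0 ^ n = qfact q n * ?L"
    unfolding q_Cauchy_binomial[OF q, of n 0, symmetric] sum_distrib_left
    by (rule sum.cong) (auto simp: qbinom_def prod_neg_power)
  then show ?thesis
    using qfact_nonzero[OF q] by (cases n) auto
qed

section \<open>Reciprocal series and the pentagon identity\<close>

text \<open>The hypothesis \<open>cb\<close> says that \<open>b\<close> and \<open>c\<close> are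
  reciprocal formal power series; collecting by the total exponent of \<open>A\<close> turns the
  composition into their Cauchy product.\<close>

lemma op_series_comp_eq_id:
  assumes A: "degree_raising N 1 A"
    and cb: "\<And>n. (\<Sum>j\<le>n. c j * b (n - j)) = (if n = 0 then 1 else 0)"
  shows "op_series b A \<circ> op_series c A = id"
proof (intro ext)
  fix f m
  let ?K = "total_degree N m"
  have "(op_series b A \<circ> op_series c A) f m
      = (\<Sum>j\<le>?K. c j * (\<Sum>i\<le>?K. b i * (A ^^ (i + j)) f m))"
    unfolding o_apply degree_raising_apply_op_series[OF degree_raising_op_series[OF A] A order_refl]
    by (simp add: op_series_eq_sum[OF A order_refl] funpow_add)
  also have "\<dots> = (\<Sum>j\<le>?K. \<Sum>n\<le>?K. if j \<le> n then c j * b (n - j) * (A ^^ n) f m else 0)"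
    by (subst sum_atMost_shift)
      (auto intro!: degree_raising_funpow_vanish[OF A] sum.cong simp: sum_distrib_left)
  also have "\<dots> = (\<Sum>n\<le>?K. \<Sum>j\<le>?K. if j \<le> n then c j * b (n - j) * (A ^^ n) f m else 0)"
    by (rule sum.swap)
  also have "\<dots> = (\<Sum>n\<le>?K. (\<Sum>j\<le>n. c j * b (n - j)) * (A ^^ n) f m)"
    unfolding sum_distrib_right by (intro sum.cong refl sum.mono_neutral_cong_right) auto
  also have "\<dots> = (\<Sum>n\<le>?K. if n = 0 then f m else 0)"
    unfolding cb by (rule sum.cong) auto
  also have "\<dots> = id f m"
    by simp
  finally show "(op_series b A \<circ> op_series c A) f m = id f m" .
qed

lemma e_q_phi:
  assumes "norm q < 1" "degree_raising N 1 A"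
  shows "e_q q A \<circ> phi q A = id"
  unfolding e_q_def phi_def
  by (rule op_series_comp_eq_id[OF assms(2)]) (rule phi_e_q_coefficient[OF assms(1)])

lemma phi_e_q:
  assumes "norm q < 1" "degree_raising N 1 A"
  shows "phi q A \<circ> e_q q A = id"
  unfolding e_q_def phi_def
proof (rule op_series_comp_eq_id[OF assms(2)])
  fix n
  show "(\<Sum>j\<le>n. 1 / qfact q j * (q ^ ((n - j) * (n - j - 1) div 2) * (- 1) ^ (n - j) / qfact q (n - j)))
     = (if n = 0 then 1 else 0)"
    \<comment> \<open>Read backwards, the known identity turns the goal into the same convolution in
      reversed order.\<close>
    unfolding phi_e_q_coefficient[OF assms(1), symmetric]
    by (rule sum.reindex_bij_witness[of _ "\<lambda>j. n - j" "\<lambda>j. n - j"]) auto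
qed

text \<open>Each of the \<open>i\<close> factors \<open>Y\<close> crosses each of the
  \<open>j\<close> factors \<open>X\<close> at the cost of one \<open>q\<close>.\<close>

lemma funpow_q_commute:
  assumes X: "degree_raising N k X" and Y: "degree_raising N l Y"
    and YX: "Y \<circ> X = op_scale q (X \<circ> Y)"
  shows "(Y ^^ i) ((X ^^ j) f) = (\<lambda>m. q ^ (i * j) * (X ^^ j) ((Y ^^ i) f) m)"
proof -
  note Xn = degree_raising_scale[OF degree_raising_funpow[OF X]]
  note Yn = degree_raising_scale[OF degree_raising_funpow[OF Y]]
  have YX: "Y (X f) = (\<lambda>m. q * X (Y f) m)" for f
    using YX by (simp add: fun_eq_iff op_scale_def)
  have YXj: "Y ((X ^^ j) f) = (\<lambda>m. q ^ j * (X ^^ j) (Y f) m)" for f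
    by (induction j) (simp_all add: YX degree_raising_scale[OF X] mult.assoc)
  show ?thesis
    by (induction i) (simp_all add: YXj degree_raising_scale[OF Y] power_add mult_ac)
qed

text \<open>A further \<open>X \<circ> Y\<close> in front has to move its \<open>Y\<close> across
  \<open>j\<close> factors \<open>X\<close>, so the exponents of \<open>q\<close> add up to
  \<open>0 + 1 + ... + (j - 1)\<close>.\<close>

lemma funpow_neg_comp:
  assumes X: "degree_raising N k X" and Y: "degree_raising N l Y"
    and YX: "Y \<circ> X = op_scale q (X \<circ> Y)"
  shows "(op_scale (- 1) (X \<circ> Y) ^^ j) f
    = (\<lambda>m. (- 1) ^ j * q ^ (j * (j - 1) div 2) * (X ^^ j) ((Y ^^ j) f) m)"
proof (induction j)
  case (Suc j)
  let ?Z = "op_scale (- 1) (X \<circ> Y)"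
  have Z: "?Z g = (\<lambda>m. - 1 * X (Y g) m)" for g
    by (simp add: op_scale_def)
  have Y1: "Y ((X ^^ j) g) = (\<lambda>m. q ^ j * (X ^^ j) (Y g) m)" for g
    using funpow_q_commute[OF assms, of 1] by simp
  have "(?Z ^^ Suc j) f = ?Z ((?Z ^^ j) f)"
    by simp
  also have "\<dots> = (\<lambda>m. (- 1) ^ Suc j * q ^ (Suc j * (Suc j - 1) div 2)
      * (X ^^ Suc j) ((Y ^^ Suc j) f) m)"
    unfolding Suc Z degree_raising_scale[OF X] degree_raising_scale[OF Y] Y1 power_choose_two_Suc
    by (simp add: mult_ac)
  finally show ?case .
qed simp

text \<open>Both sides are expanded at one exponent \<open>m\<close> into normally ordered terms
  \<open>X^i Y^k\<close>. On the right, exponents \<open>i\<close>, \<open>j\<close>,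
  \<open>k\<close> of the three factors contribute to \<open>X^(i+j) Y^(j+k)\<close>; collecting by
  the final exponents leaves the sum over \<open>j\<close> in
  \<open>pentagon_coefficient\<close>.\<close>

lemma e_q_pentagon:
  assumes q: "norm q < 1" and X: "degree_raising N 1 X" and Y: "degree_raising N 1 Y"
    and YX: "Y \<circ> X = op_scale q (X \<circ> Y)"
  shows "e_q q Y \<circ> e_q q X = e_q q X \<circ> e_q q (op_scale (- 1) (X \<circ> Y)) \<circ> e_q q Y"
proof (intro ext)
  fix f m
  define Z where "Z = op_scale (- 1) (X \<circ> Y)"
  define K where "K = total_degree N m"
  define t where "t i k = (X ^^ i) ((Y ^^ k) f) m" for i k
  define c where "c = (\<lambda>n. 1 / qfact q n)"
  define s where "s j = (- 1) ^ j * q ^ (j * (j - 1) div 2)" for j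
  have m: "total_degree N m \<le> K" by (simp add: K_def)
  have Z: "degree_raising N 1 Z"
    unfolding Z_def
    by (rule degree_raising_op_scale, rule degree_raising_mono[OF degree_raising_comp[OF X Y]]) simp
  \<comment> \<open>\<open>X^i Y^k\<close> raises the degree by \<open>i + k\<close>. This allows
    one bound \<open>K\<close> for all three indices and justifies the two reindexings
    below.\<close>
  have t0: "t i k = 0" if "i + k > K" for i k
    unfolding t_def
    using degree_raising_vanish[OF degree_raising_comp[OF
          degree_raising_funpow[OF X, of i] degree_raising_funpow[OF Y, of k]], of 0 f m] that
    by (simp add: K_def)
  have t_add: "t (i + j) (k + j) = (X ^^ i) ((X ^^ j) ((Y ^^ j) ((Y ^^ k) f))) m" for i j k
    by (simp add: t_def funpow_add add.commute[of k j])
  have e: "e_q q = op_series c"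
    by (simp add: e_q_def c_def fun_eq_iff)
  note s0 = degree_raising_op_series[of N _ c]
  have "(e_q q X \<circ> e_q q Z) (e_q q Y f) m
      = (\<Sum>k\<le>K. c k * (e_q q X \<circ> e_q q Z) ((Y ^^ k) f) m)"
    unfolding e using s0[OF X] s0[OF Z]
    by (intro degree_raising_apply_op_series[OF degree_raising_comp[of _ 0 _ 0, simplified] Y m])
      (simp_all add: o_def)
  also have "\<dots> = (\<Sum>k\<le>K. c k * (\<Sum>j\<le>K. c j * e_q q X ((Z ^^ j) ((Y ^^ k) f)) m))"
    unfolding e o_apply degree_raising_apply_op_series[OF s0[OF X] Z m] ..
  also have "\<dots> = (\<Sum>k\<le>K. c k * (\<Sum>j\<le>K. c j * (\<Sum>i\<le>K. c i * (X ^^ i) ((Z ^^ j) ((Y ^^ k) f)) m)))"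
    unfolding e op_series_eq_sum[OF X m] ..
  also have "\<dots> = (\<Sum>k\<le>K. c k * (\<Sum>j\<le>K. c j * s j * (\<Sum>i\<le>K. c i * t (i + j) (k + j))))"
    unfolding Z_def funpow_neg_comp[OF X Y YX] degree_raising_scale[OF degree_raising_funpow[OF X]]
    by (simp add: t_add s_def sum_distrib_left mult_ac)
  also have "\<dots> = (\<Sum>j\<le>K. c j * s j * (\<Sum>k\<le>K. c k * (\<Sum>i\<le>K. c i * t (i + j) (k + j))))"
    unfolding sum_distrib_left by (subst sum.swap) (simp add: mult_ac)
  also have "\<dots> = (\<Sum>j\<le>K. \<Sum>k\<le>K. \<Sum>i\<le>K.
      if j \<le> k \<and> j \<le> i then s j * c (i - j) * c j * c (k - j) * t i k else 0)"
  proof (rule sum.cong)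
    fix j
    have "(\<Sum>k\<le>K. c k * (\<Sum>i\<le>K. c i * t (i + j) (k + j)))
       = (\<Sum>k\<le>K. if j \<le> k then c (k - j) * (\<Sum>i\<le>K. c i * t (i + j) k) else 0)"
      by (rule sum_atMost_shift) (simp add: t0)
    also have "\<dots> = (\<Sum>k\<le>K. if j \<le> k then c (k - j) *
        (\<Sum>i\<le>K. if j \<le> i then c (i - j) * t i k else 0) else 0)"
      by (subst sum_atMost_shift) (simp_all add: t0)
    finally show "c j * s j * (\<Sum>k\<le>K. c k * (\<Sum>i\<le>K. c i * t (i + j) (k + j))) =
      (\<Sum>k\<le>K. \<Sum>i\<le>K. if j \<le> k \<and> j \<le> i then s j * c (i - j) * c j * c (k - j) * t i k else 0)"
      by (auto simp: sum_distrib_left mult_ac intro!: sum.cong)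
  qed simp
  also have "\<dots> = (\<Sum>k\<le>K. \<Sum>i\<le>K. \<Sum>j\<le>K.
      if j \<le> k \<and> j \<le> i then s j * c (i - j) * c j * c (k - j) * t i k else 0)"
    by (subst sum.swap) (intro sum.cong refl sum.swap)
  also have "\<dots> = (\<Sum>k\<le>K. \<Sum>i\<le>K. (\<Sum>j\<le>K. if j \<le> i \<and> j \<le> k then s j /
      (qfact q (i - j) * qfact q j * qfact q (k - j)) else 0) * t i k)"
    unfolding sum_distrib_right by (intro sum.cong) (auto simp: c_def)
  also have "\<dots> = (\<Sum>k\<le>K. \<Sum>i\<le>K. q ^ (i * k) / (qfact q i * qfact q k) * t i k)"
    unfolding s_def by (intro sum.cong refl arg_cong2[of _ _ _ _ "(*)"] pentagon_coefficient[OF q]) simp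
  also have "\<dots> = (\<Sum>i\<le>K. c i * (\<Sum>k\<le>K. c k * (q ^ (k * i) * t i k)))"
    by (subst sum.swap) (simp add: c_def sum_distrib_left mult_ac)
  \<comment> \<open>The power \<open>q ^ (k * i)\<close> is the cost of normally ordering
    \<open>Y^k X^i\<close>, so the left side of the pentagon reappears.\<close>
  also have "\<dots> = (\<Sum>i\<le>K. c i * op_series c Y ((X ^^ i) f) m)"
    unfolding op_series_eq_sum[OF Y m] funpow_q_commute[OF X Y YX] t_def ..
  also have "\<dots> = (e_q q Y \<circ> e_q q X) f m"
    unfolding e o_apply degree_raising_apply_op_series[OF s0[OF Y] X m] ..
  finally show "(e_q q Y \<circ> e_q q X) f m
      = (e_q q X \<circ> e_q q (op_scale (- 1) (X \<circ> Y)) \<circ> e_q q Y) f m"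
    by (simp add: Z_def)
qed

text \<open>\<open>inv_into\<close> is meaningful only on the image of
  \<open>power_series N\<close>. As \<open>B\<close> preserves that set, \<open>f = A (B f)\<close>
  lies in the image; injectivity comes from \<open>B\<close> being a left inverse.\<close>

lemma op_inverse_eq:
  assumes "A \<circ> B = id" "B \<circ> A = id" "degree_raising N k A" "degree_raising N l B"
    and "f \<in> power_series N"
  shows "op_inverse N A f = B f"
proof -
  have AB: "A (B g) = g" "B (A g) = g" for g
    using assms(1,2) by (simp_all add: fun_eq_iff)
  have "inv_into (power_series N) A (A (B f)) = B f"
    by (rule inv_into_f_f)
      (use AB assms(4,5) in \<open>auto intro: degree_raising_power_series inj_on_inverseI[of _ B]\<close>)
  then show ?thesis by (simp add: AB op_inverse_def)
qed

section \<open>Conjugation along an open chain of q-commuting operators\<close>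

text \<open>In the induction step the factors of index \<open>n + 1\<close> form the outermost pair
  of the conjugation, so the induction hypothesis can be used inside. The pentagon then applies with
  \<open>X\<close> built from the product of \<open>a 0\<close>, ..., \<open>a n\<close> and
  \<open>Y\<close> from the new neighbour.\<close>

lemma left_conjugation:
  assumes q: "norm q < 1"
    and a: "\<And>i. i \<le> k \<Longrightarrow> degree_raising N 1 (a i)"
    and adj: "\<And>i. i < k \<Longrightarrow> a (Suc i) \<circ> a i = op_scale q (a i \<circ> a (Suc i))"
    and far: "\<And>i j. i + 2 \<le> j \<Longrightarrow> j \<le> k \<Longrightarrow> a i \<circ> a j = a j \<circ> a i"
    and "n \<le> k"
  shows "op_prod (map (\<lambda>i. e_q q (op_scale (- 1) (a i))) (rev [1..<n + 1]))
      \<circ> e_q q (op_scale (- 1) (a 0))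
      \<circ> op_prod (map (\<lambda>i. phi q (op_scale (- 1) (a i))) [1..<n + 1])
    = op_prod (map (\<lambda>j. e_q q (op_scale (- 1) (op_prod (map a [0..<j + 1])))) [0..<n + 1])"
  using \<open>n \<le> k\<close>
proof (induction n)
  case 0
  then show ?case by simp
next
  case (Suc n)
  let ?e = "\<lambda>i. e_q q (op_scale (- 1) (a i))" and ?p = "\<lambda>i. phi q (op_scale (- 1) (a i))"
  let ?b = "\<lambda>j. op_prod (map a [0..<j])"
  let ?E = "\<lambda>j. e_q q (op_scale (- 1) (?b (j + 1)))"
  \<comment> \<open>The two signs cancel in \<open>X \<circ> Y\<close>, so the minus sign of the
    pentagon is exactly the one carried by the new factor \<open>?E (Suc n)\<close>.\<close>
  define X Y where "X = op_scale (- 1) (?b (n + 1))" and "Y = op_scale (- 1) (a (Suc n))"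
  have a': "degree_raising N 1 (a (Suc n))"
    using a Suc.prems by simp
  have b: "degree_raising N 1 (?b (j + 1))" if "j \<le> n" for j
    by (rule degree_raising_op_prod_nonempty) (use that Suc.prems a in auto)
  have X: "degree_raising N 1 X" and Y: "degree_raising N 1 Y"
    unfolding X_def Y_def using a' b by (auto intro!: degree_raising_op_scale)
  \<comment> \<open>\<open>?b j\<close> involves only \<open>a i\<close> with \<open>i < j\<close>;
    thus \<open>j \<le> n\<close> keeps the neighbour \<open>a n\<close> out.\<close>
  have comm: "a (Suc n) \<circ> ?b j = ?b j \<circ> a (Suc n)" if "j \<le> n" for j
    by (rule op_prod_commute) (use that Suc.prems far[of _ "Suc n"] in auto)
  have XY: "X \<circ> Y = ?b (Suc n + 1)"
    unfolding X_def Y_def op_scale_comp comp_op_scale[OF b[OF order_refl]] op_scale_op_scale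
    by (simp add: op_scale_1 op_prod_append comp_assoc)
  have "Y \<circ> X = a (Suc n) \<circ> ?b n \<circ> a n"
    unfolding X_def Y_def op_scale_comp comp_op_scale[OF a'] op_scale_op_scale
    by (simp add: op_scale_1 op_prod_append comp_assoc)
  also have "\<dots> = ?b n \<circ> (a (Suc n) \<circ> a n)"
    using comm[of n] by (simp add: comp_assoc)
  \<comment> \<open>For \<open>n = 0\<close> the product \<open>?b n\<close> is the identity, hence
    the shift 0 here.\<close>
  also have "\<dots> = op_scale q (?b n \<circ> (a n \<circ> a (Suc n)))"
    unfolding adj[OF Suc_le_lessD[OF Suc.prems]]
    by (rule comp_op_scale[where N = N and k = 0], rule degree_raising_op_prod)
      (use a Suc.prems in \<open>auto intro: degree_raising_mono[of _ 1]\<close>)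
  also have "\<dots> = op_scale q (X \<circ> Y)"
    unfolding XY by (simp add: op_prod_append comp_assoc)
  finally have YX: "Y \<circ> X = op_scale q (X \<circ> Y)" .
  have E_comm: "e_q q Y \<circ> op_prod (map ?E [0..<n]) = op_prod (map ?E [0..<n]) \<circ> e_q q Y"
  proof (rule op_prod_commute)
    fix B assume "B \<in> set (map ?E [0..<n])"
    then obtain j where j: "j < n" "B = ?E j"
      by auto
    have "Y \<circ> op_scale (- 1) (?b (j + 1)) = op_scale (- 1) (?b (j + 1)) \<circ> Y"
      using comm[of "j + 1"] j unfolding Y_def
      by (simp only: op_scale_comp comp_op_scale[OF a'] comp_op_scale[OF b])
    then show "e_q q Y \<circ> B = B \<circ> e_q q Y"
      unfolding j(2) by (intro e_q_commute[OF Y degree_raising_op_scale[OF b]]) (use j in auto)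
  qed
  have pent: "e_q q Y \<circ> e_q q X \<circ> phi q Y = e_q q X \<circ> e_q q (op_scale (- 1) (X \<circ> Y))"
    by (simp only: e_q_pentagon[OF q X Y YX] comp_assoc e_q_phi[OF q Y] comp_id)
  have "op_prod (map ?e (rev [1..<Suc n + 1])) \<circ> ?e 0 \<circ> op_prod (map ?p [1..<Suc n + 1])
      = e_q q Y \<circ> (op_prod (map ?e (rev [1..<n + 1])) \<circ> ?e 0 \<circ> op_prod (map ?p [1..<n + 1]))
         \<circ> phi q Y"
    by (simp add: op_prod_append comp_assoc Y_def)
  also have "\<dots> = e_q q Y \<circ> op_prod (map ?E [0..<n]) \<circ> (e_q q X \<circ> phi q Y)"
    unfolding Suc.IH[OF Suc_leD[OF Suc.prems]] by (simp add: op_prod_append comp_assoc X_def)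
  also have "\<dots> = op_prod (map ?E [0..<n]) \<circ> (e_q q Y \<circ> e_q q X \<circ> phi q Y)"
    unfolding E_comm by (simp add: comp_assoc)
  also have "\<dots> = op_prod (map ?E [0..<Suc n + 1])"
    unfolding pent XY by (simp add: op_prod_append comp_assoc X_def)
  finally show ?case .
qed

text \<open>The mirror image: products and the q-commutation of neighbours are both reversed. So the
  new neighbour is now the \<open>X\<close> of the pentagon, and \<open>phi q X\<close> cancels its
  first factor instead of its last.\<close>

lemma right_conjugation:
  assumes q: "norm q < 1"
    and a: "\<And>i. i \<le> k \<Longrightarrow> degree_raising N 1 (a i)"
    and adj: "\<And>i. i < k \<Longrightarrow> a i \<circ> a (Suc i) = op_scale q (a (Suc i) \<circ> a i)"
    and far: "\<And>i j. i + 2 \<le> j \<Longrightarrow> j \<le> k \<Longrightarrow> a i \<circ> a j = a j \<circ> a i"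
    and "n \<le> k"
  shows "op_prod (map (\<lambda>i. phi q (op_scale (- 1) (a i))) (rev [1..<n + 1]))
      \<circ> e_q q (op_scale (- 1) (a 0))
      \<circ> op_prod (map (\<lambda>i. e_q q (op_scale (- 1) (a i))) [1..<n + 1])
    = op_prod (map (\<lambda>j. e_q q (op_scale (- 1) (op_prod (map a (rev [0..<j + 1])))))
        (rev [0..<n + 1]))"
  using \<open>n \<le> k\<close>
proof (induction n)
  case 0
  then show ?case by simp
next
  case (Suc n)
  let ?e = "\<lambda>i. e_q q (op_scale (- 1) (a i))" and ?p = "\<lambda>i. phi q (op_scale (- 1) (a i))"
  let ?b = "\<lambda>j. op_prod (map a (rev [0..<j]))"
  let ?E = "\<lambda>j. e_q q (op_scale (- 1) (?b (j + 1)))"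
  define X Y where "X = op_scale (- 1) (a (Suc n))" and "Y = op_scale (- 1) (?b (n + 1))"
  have a': "degree_raising N 1 (a (Suc n))"
    using a Suc.prems by simp
  have b: "degree_raising N 1 (?b (j + 1))" if "j \<le> n" for j
    by (rule degree_raising_op_prod_nonempty) (use that Suc.prems a in auto)
  have X: "degree_raising N 1 X" and Y: "degree_raising N 1 Y"
    unfolding X_def Y_def using a' b by (auto intro!: degree_raising_op_scale)
  have comm: "a (Suc n) \<circ> ?b j = ?b j \<circ> a (Suc n)" if "j \<le> n" for j
    by (rule op_prod_commute) (use that Suc.prems far[of _ "Suc n"] in auto)
  have XY: "X \<circ> Y = ?b (Suc n + 1)"
    unfolding X_def Y_def op_scale_comp comp_op_scale[OF a'] op_scale_op_scale
    by (simp add: op_scale_1 comp_assoc)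
  have "Y \<circ> X = a n \<circ> (?b n \<circ> a (Suc n))"
    unfolding X_def Y_def op_scale_comp comp_op_scale[OF b[OF order_refl]] op_scale_op_scale
    by (simp add: op_scale_1 comp_assoc)
  also have "\<dots> = (a n \<circ> a (Suc n)) \<circ> ?b n"
    using comm[of n] by (simp add: comp_assoc)
  also have "\<dots> = op_scale q (a (Suc n) \<circ> a n \<circ> ?b n)"
    unfolding adj[OF Suc_le_lessD[OF Suc.prems]] op_scale_comp ..
  also have "\<dots> = op_scale q (X \<circ> Y)"
    unfolding XY by (simp add: comp_assoc)
  finally have YX: "Y \<circ> X = op_scale q (X \<circ> Y)" .
  have E_comm: "e_q q X \<circ> op_prod (map ?E (rev [0..<n])) = op_prod (map ?E (rev [0..<n])) \<circ> e_q q X"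
  proof (rule op_prod_commute)
    fix B assume "B \<in> set (map ?E (rev [0..<n]))"
    then obtain j where j: "j < n" "B = ?E j"
      by auto
    have "X \<circ> op_scale (- 1) (?b (j + 1)) = op_scale (- 1) (?b (j + 1)) \<circ> X"
      using comm[of "j + 1"] j unfolding X_def
      by (simp only: op_scale_comp comp_op_scale[OF a'] comp_op_scale[OF b])
    then show "e_q q X \<circ> B = B \<circ> e_q q X"
      unfolding j(2) by (intro e_q_commute[OF X degree_raising_op_scale[OF b]]) (use j in auto)
  qed
  have "phi q X \<circ> (e_q q Y \<circ> e_q q X)
      = phi q X \<circ> e_q q X \<circ> (e_q q (op_scale (- 1) (X \<circ> Y)) \<circ> e_q q Y)"
    by (simp only: e_q_pentagon[OF q X Y YX] comp_assoc)
  then have pent: "phi q X \<circ> (e_q q Y \<circ> e_q q X) = e_q q (op_scale (- 1) (X \<circ> Y)) \<circ> e_q q Y"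
    by (simp only: phi_e_q[OF q X] id_comp)
  have "op_prod (map ?p (rev [1..<Suc n + 1])) \<circ> ?e 0 \<circ> op_prod (map ?e [1..<Suc n + 1])
      = phi q X \<circ> (op_prod (map ?p (rev [1..<n + 1])) \<circ> ?e 0 \<circ> op_prod (map ?e [1..<n + 1]))
         \<circ> e_q q X"
    by (simp add: op_prod_append comp_assoc X_def)
  also have "\<dots> = phi q X \<circ> e_q q Y \<circ> (op_prod (map ?E (rev [0..<n])) \<circ> e_q q X)"
    unfolding Suc.IH[OF Suc_leD[OF Suc.prems]] by (simp add: comp_assoc Y_def)
  also have "\<dots> = phi q X \<circ> (e_q q Y \<circ> e_q q X) \<circ> op_prod (map ?E (rev [0..<n]))"
    unfolding E_comm[symmetric] by (simp add: comp_assoc)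
  also have "\<dots> = op_prod (map ?E (rev [0..<Suc n + 1]))"
    unfolding pent XY by (simp add: comp_assoc Y_def)
  finally show ?case .
qed

section \<open>Commutation relations of the concrete operators\<close>

lemma degree_raising_mult_var:
  assumes "N > 0"
  shows "degree_raising N 1 (mult_var N i)"
  unfolding degree_raising_def
proof (intro conjI allI impI ballI)
  let ?j = "i mod N"
  have j: "?j < N"
    using assms by simp
  fix f :: mseries and n m
  assume f: "\<forall>m. total_degree N m < n \<longrightarrow> f m = 0" and m: "total_degree N m < n + 1"
  show "mult_var N i f m = 0"
  proof (cases "m ?j = 0")
    case False
    have "Suc (total_degree N (m(?j := m ?j - 1))) = total_degree N m"
      unfolding total_degree_def using j False by (simp add: sum.remove[of "{..<N}" ?j])
    then have "f (m(?j := m ?j - 1)) = 0"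
      using m by (intro f[rule_format]) simp
    then show ?thesis
      by (simp add: mult_var_def Let_def)
  qed (simp add: mult_var_def)
next
  let ?j = "i mod N"
  have j: "?j < N"
    using assms by simp
  fix f assume f: "f \<in> power_series N"
  show "mult_var N i f \<in> power_series N"
    unfolding power_series_def mem_Collect_eq
  proof (intro allI impI)
    fix m l assume "mult_var N i f m \<noteq> 0" and l: "N \<le> l"
    then have "f (m(?j := m ?j - 1)) \<noteq> 0"
      by (auto simp: mult_var_def Let_def split: if_splits)
    then have "(m(?j := m ?j - 1)) l = 0"
      using f l unfolding power_series_def mem_Collect_eq by blast
    then show "m l = 0"
      using j l by simp
  qed
qed (simp_all add: mult_var_def Let_def fun_eq_iff)

lemma degree_raising_scale_var: "degree_raising N 0 (scale_var N c i)"
  by (auto simp: degree_raising_def scale_var_def algebra_simps power_series_def)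

text \<open>Common form of both families: \<open>s = inverse q\<close> gives the check operators and
  \<open>s = q\<close>, up to a scalar, the hat operators. One computation then yields both
  commutation relations, in opposite directions.\<close>

definition twisted_var :: "nat \<Rightarrow> complex \<Rightarrow> nat \<Rightarrow> mop" where
  "twisted_var N s i = mult_var N i \<circ> scale_var N s i \<circ> scale_var N (inverse s) (i + N - 1)"

lemma x_check_eq: "x_check N q = twisted_var N (inverse q)"
  by (simp add: x_check_def twisted_var_def fun_eq_iff)

lemma x_hat_eq: "x_hat N q d d' i = op_scale (d (i mod N) * d' (i mod N)) (twisted_var N q i)"
  by (simp add: x_hat_def twisted_var_def)

lemma degree_raising_twisted_var:
  "N > 0 \<Longrightarrow> degree_raising N 1 (twisted_var N s i)"
  unfolding twisted_var_def
  using degree_raising_comp[OF degree_raising_comp[OF degree_raising_mult_var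
      degree_raising_scale_var] degree_raising_scale_var] by simp

lemma pred_mod_eq: "(i::nat) < N \<Longrightarrow> (i + N - 1) mod N = (if i = 0 then N - 1 else i - 1)"
  by (cases i) auto

text \<open>Multiplication by the variable acts last, so the power of \<open>s\<close> sees the
  lowered exponent \<open>m i - 1\<close>. Since \<open>2 \<le> N\<close>, the predecessor
  \<open>p\<close> differs from \<open>i\<close> and keeps its exponent.\<close>

lemma twisted_var_apply:
  assumes "i < N" "2 \<le> N" "p = (if i = 0 then N - 1 else i - 1)"
  shows "twisted_var N s i f m
    = (if m i = 0 then 0 else s ^ (m i - 1) * inverse s ^ m p * f (m(i := m i - 1)))"
proof -
  have "p \<noteq> i" "i mod N = i"
    using assms by auto
  then show ?thesis
    using pred_mod_eq[OF assms(1)] assms(3)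
    by (simp add: twisted_var_def mult_var_def scale_var_def Let_def)
qed

text \<open>The factor \<open>s\<close> arises where the inverse scaling of \<open>x_i\<close>
  inside the operator of index \<open>Suc i\<close> meets multiplication by \<open>x_i\<close>. The
  bound forces \<open>N \<ge> 3\<close>; for \<open>N = 2\<close> the indices 0 and 1 would be
  neighbours on both sides.\<close>

lemma twisted_var_adjacent:
  assumes "Suc i < N - 1" "s \<noteq> 0"
  shows "twisted_var N s i \<circ> twisted_var N s (Suc i)
    = op_scale s (twisted_var N s (Suc i) \<circ> twisted_var N s i)"
proof (intro ext)
  fix f m
  define p where "p = (if i = 0 then N - 1 else i - 1)"
  have p: "p \<noteq> i" "p \<noteq> Suc i" and N: "i < N" "Suc i < N" "2 \<le> N"
    using assms by (auto simp: p_def)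
  show "(twisted_var N s i \<circ> twisted_var N s (Suc i)) f m
      = op_scale s (twisted_var N s (Suc i) \<circ> twisted_var N s i) f m"
    using p assms(2)
    by (cases "m i")
      (simp_all add: op_scale_def twisted_var_apply[OF N(1,3) p_def] twisted_var_apply[OF N(2,3) refl]
        fun_upd_twist[of i "Suc i"] field_simps)
qed

text \<open>Neither operator scales the variable that the other multiplies by;
  \<open>j < N - 1\<close> rules out that \<open>j\<close> is the cyclic predecessor of
  \<open>i = 0\<close>.\<close>

lemma twisted_var_commute:
  assumes "i + 2 \<le> j" "j < N - 1"
  shows "twisted_var N s i \<circ> twisted_var N s j = twisted_var N s j \<circ> twisted_var N s i"
proof (intro ext)
  fix f m
  define p where "p = (if i = 0 then N - 1 else i - 1)"
  define r where "r = (if j = 0 then N - 1 else j - 1)"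
  have p: "p \<noteq> i" "p \<noteq> j" "r \<noteq> i" "r \<noteq> j" "i \<noteq> j" and N: "i < N" "j < N" "2 \<le> N"
    using assms by (auto simp: p_def r_def)
  show "(twisted_var N s i \<circ> twisted_var N s j) f m = (twisted_var N s j \<circ> twisted_var N s i) f m"
    using p
    by (simp add: twisted_var_apply[OF N(1,3) p_def] twisted_var_apply[OF N(2,3) r_def]
        fun_upd_twist[of i j])
qed

lemma degree_raising_x_check: "N > 0 \<Longrightarrow> degree_raising N 1 (x_check N q i)"
  by (simp add: x_check_eq degree_raising_twisted_var[unfolded One_nat_def])

lemma degree_raising_x_hat: "N > 0 \<Longrightarrow> degree_raising N 1 (x_hat N q d d' i)"
  by (simp add: x_hat_eq degree_raising_op_scale degree_raising_twisted_var[unfolded One_nat_def])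

lemma op_scale_comp_op_scale:
  "degree_raising N k A \<Longrightarrow> op_scale b A \<circ> op_scale c B = op_scale (b * c) (A \<circ> B)"
  by (simp add: op_scale_comp comp_op_scale op_scale_op_scale)

section \<open>Trading inverses for \<open>e_q\<close> on power series\<close>

text \<open>The factors are replaced from the right, since each one needs its argument, the partial
  product applied to \<open>f\<close>, to lie in \<open>power_series N\<close>.\<close>

lemma op_prod_op_inverse:
  assumes "\<And>i. i \<in> set ks \<Longrightarrow> A i \<circ> B i = id" "\<And>i. i \<in> set ks \<Longrightarrow> B i \<circ> A i = id"
    and "\<And>i. i \<in> set ks \<Longrightarrow> degree_raising N k (A i)"
    and "\<And>i. i \<in> set ks \<Longrightarrow> degree_raising N 0 (B i)"
    and "f \<in> power_series N"
  shows "op_prod (map (\<lambda>i. op_inverse N (A i)) ks) f = op_prod (map B ks) f"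
  using assms
proof (induction ks)
  case (Cons i ks)
  have "op_prod (map B ks) f \<in> power_series N"
    by (rule degree_raising_power_series[OF degree_raising_op_prod]) (use Cons.prems in auto)
  then have "op_inverse N (A i) (op_prod (map B ks) f) = B i (op_prod (map B ks) f)"
    by (intro op_inverse_eq[where k = k and l = 0] Cons.prems) simp_all
  then show ?case
    using Cons by simp
qed simp

lemma op_prod_inverse:
  assumes "\<And>i. i \<in> set ks \<Longrightarrow> A i \<circ> B i = id"
  shows "op_prod (map A ks) \<circ> op_prod (map B (rev ks)) = id"
  using assms
proof (induction ks)
  case (Cons i ks)
  have "op_prod (map A (i # ks)) \<circ> op_prod (map B (rev (i # ks)))
      = A i \<circ> (op_prod (map A ks) \<circ> op_prod (map B (rev ks))) \<circ> B i"
    by (simp add: op_prod_append comp_assoc)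
  also have "op_prod (map A ks) \<circ> op_prod (map B (rev ks)) = id"
    by (rule Cons.IH) (use Cons.prems in auto)
  also have "A i \<circ> id \<circ> B i = id"
    by (simp only: comp_id Cons.prems list.set_intros)
  finally show ?case .
qed simp

lemma op_inverse_phi:
  assumes "norm q < 1" "degree_raising N 1 A" "f \<in> power_series N"
  shows "op_inverse N (phi q A) f = e_q q A f"
  by (rule op_inverse_eq[OF phi_e_q e_q_phi degree_raising_phi degree_raising_e_q])
    (fact assms)+

lemma op_prod_op_inverse_phi:
  assumes q: "norm q < 1" and A: "\<And>i. i \<in> set ks \<Longrightarrow> degree_raising N 1 (A i)"
    and f: "f \<in> power_series N"
  shows "op_prod (map (\<lambda>i. op_inverse N (phi q (A i))) ks) f = op_prod (map (\<lambda>i. e_q q (A i)) ks) f"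
proof (rule op_prod_op_inverse[where N = N and k = 0, OF _ _ _ _ f])
  fix i assume "i \<in> set ks"
  note Ai = A[OF this]
  show "phi q (A i) \<circ> e_q q (A i) = id" "e_q q (A i) \<circ> phi q (A i) = id"
    by (rule phi_e_q[OF q Ai], rule e_q_phi[OF q Ai])
  show "degree_raising N 0 (phi q (A i))" "degree_raising N 0 (e_q q (A i))"
    by (rule degree_raising_phi[OF Ai], rule degree_raising_e_q[OF Ai])
qed

lemma op_inverse_op_prod_phi:
  assumes q: "norm q < 1" and A: "\<And>i. i \<in> set ks \<Longrightarrow> degree_raising N 1 (A i)"
    and f: "f \<in> power_series N"
  shows "op_inverse N (op_prod (map (\<lambda>i. phi q (A i)) ks)) f
    = op_prod (map (\<lambda>i. e_q q (A i)) (rev ks)) f"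
proof (rule op_inverse_eq[where k = 0 and l = 0, OF _ _ _ _ f])
  show "op_prod (map (\<lambda>i. phi q (A i)) ks) \<circ> op_prod (map (\<lambda>i. e_q q (A i)) (rev ks)) = id"
    by (rule op_prod_inverse) (rule phi_e_q[OF q A])
  show "op_prod (map (\<lambda>i. e_q q (A i)) (rev ks)) \<circ> op_prod (map (\<lambda>i. phi q (A i)) ks) = id"
    using op_prod_inverse[of "rev ks" "\<lambda>i. e_q q (A i)" "\<lambda>i. phi q (A i)"] e_q_phi[OF q A] by simp
  show "degree_raising N 0 (op_prod (map (\<lambda>i. phi q (A i)) ks))"
    by (rule degree_raising_op_prod) (auto intro: degree_raising_phi[OF A])
  show "degree_raising N 0 (op_prod (map (\<lambda>i. e_q q (A i)) (rev ks)))"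
    by (rule degree_raising_op_prod) (auto intro: degree_raising_e_q[OF A])
qed

section \<open>The identities for the left and right blocks\<close>

lemma degree_raising_Lam:
  assumes "N > 0"
  shows "degree_raising N 1 (Lam N)"
  unfolding Lam_def
proof (rule degree_raising_op_prod_nonempty)
  fix A assume "A \<in> set (map (mult_var N) [1..<N + 1])"
  then obtain i where "A = mult_var N i"
    by auto
  then show "degree_raising N 1 A"
    using degree_raising_mult_var[OF assms] by simp
qed (use assms in simp)

lemma A_L_simple_eq_higher:
  assumes N: "N \<ge> 2" and q0: "q \<noteq> 0" and q: "norm q < 1" and f: "f \<in> power_series N"
  shows "A_L_simple N q f = A_L_higher N q f"
proof -
  let ?s = "\<lambda>i. op_scale (- 1) (x_check N q i)"
  have x: "degree_raising N 1 (x_check N q i)" for i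
    using N by (intro degree_raising_x_check) simp
  have s: "degree_raising N 1 (?s i)" for i
    by (rule degree_raising_op_scale[OF x])
  note V = degree_raising_power_series
  \<comment> \<open>\<open>g\<close> and \<open>h\<close> absorb the factors that both forms share
    on the right; only the conjugated factor of index 0 remains to be compared.\<close>
  define g where "g = phi q (Lam N) f"
  define h where "h = op_prod (map (\<lambda>i. e_q q (?s i)) (rev [1..<N])) g"
  have g: "g \<in> power_series N"
    unfolding g_def using N by (intro V[OF degree_raising_phi[OF degree_raising_Lam] f]) simp
  have h: "h \<in> power_series N"
    unfolding h_def by (rule V[OF degree_raising_op_prod g]) (auto intro: degree_raising_e_q[OF s])
  have G: "G_L N q h \<in> power_series N"
    unfolding G_L_def by (rule V[OF degree_raising_op_prod h]) (auto intro: degree_raising_phi[OF s])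
  have "A_L_simple N q f = op_inverse N (G_L N q) (op_inverse N (phi q (?s 0)) (G_L N q h))"
    unfolding A_L_simple_def o_apply g_def[symmetric] op_prod_op_inverse_phi[where A = ?s, OF q s g]
    by (simp add: h_def)
  also have "\<dots> = op_inverse N (G_L N q) (e_q q (?s 0) (G_L N q h))"
    unfolding op_inverse_phi[OF q s G] ..
  also have "\<dots> = (op_prod (map (\<lambda>i. e_q q (?s i)) (rev [1..<N - 1])) \<circ> e_q q (?s 0)
      \<circ> op_prod (map (\<lambda>i. phi q (?s i)) [1..<N - 1])) h"
    using op_inverse_op_prod_phi[where A = ?s and ks = "[1..<N - 1]",
        OF q s V[OF degree_raising_e_q[OF s[of 0]] G]]
    by (simp add: G_L_def)
  also have "\<dots> = op_prod (map (\<lambda>k. e_q q (op_scale (- 1) (op_prod (map (x_check N q) [0..<k + 1]))))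
       [0..<N - 1]) h"
  proof -
    \<comment> \<open>The parameter \<open>s = inverse q\<close> moves to the other side as the
      factor \<open>q\<close>.\<close>
    have adj: "x_check N q (Suc i) \<circ> x_check N q i = op_scale q (x_check N q i \<circ> x_check N q (Suc i))"
      if "i < N - 2" for i
      using twisted_var_adjacent[of i N "inverse q"] that q0
      by (simp add: x_check_eq op_scale_op_scale op_scale_1)
    have far: "x_check N q i \<circ> x_check N q j = x_check N q j \<circ> x_check N q i"
      if "i + 2 \<le> j" "j \<le> N - 2" for i j
      unfolding x_check_eq using that by (intro twisted_var_commute) auto
    \<comment> \<open>\<open>G_L\<close> runs over the indices 1, ..., \<open>N - 2\<close>, so the
      chain ends at \<open>N - 2\<close>; for \<open>N = 2\<close> the conjugation is empty.\<close>
    have N1: "N - 2 + 1 = N - 1"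
      using N by simp
    show ?thesis
      by (rule fun_cong[where x = h], rule left_conjugation[where a = "x_check N q" and k = "N - 2"
            and n = "N - 2", unfolded N1, OF q x adj far order_refl])
  qed
  also have "\<dots> = A_L_higher N q f"
    by (simp add: A_L_higher_def h_def g_def)
  finally show ?thesis .
qed

lemma A_R_simple_eq_higher:
  assumes N: "N \<ge> 2" and q0: "q \<noteq> 0" and q: "norm q < 1" and f: "f \<in> power_series N"
  shows "A_R_simple N q d d' f = A_R_higher N q d d' f"
proof -
  let ?s = "\<lambda>i. op_scale (- 1) (x_hat N q d d' i)"
  let ?e = "\<lambda>i. e_q q (?s i)"
  let ?E = "\<lambda>k. e_q q (op_scale (- 1) (op_prod (map (x_hat N q d d') (rev [0..<k + 1]))))"
  have x: "degree_raising N 1 (x_hat N q d d' i)" for i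
    using N by (intro degree_raising_x_hat) simp
  have s: "degree_raising N 1 (?s i)" for i
    by (rule degree_raising_op_scale[OF x])
  note V = degree_raising_power_series
  \<comment> \<open>Here the shared factors stand on the left, so the conjugated block acts on
    \<open>f\<close> directly: \<open>g\<close> is the inverse of \<open>G_R\<close> applied to
    \<open>f\<close>, and \<open>h\<close> the result of the whole block.\<close>
  define g where "g = op_prod (map ?e [1..<N - 1]) f"
  define h where "h = G_R N q d d' (?e 0 g)"
  have g: "g \<in> power_series N"
    unfolding g_def by (rule V[OF degree_raising_op_prod f]) (auto intro: degree_raising_e_q[OF s])
  have h: "h \<in> power_series N"
    unfolding h_def G_R_def
    by (rule V[OF degree_raising_op_prod V[OF degree_raising_e_q[OF s] g]])
      (auto intro: degree_raising_phi[OF s])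
  have "op_inverse N (G_R N q d d') f = g"
    using op_inverse_op_prod_phi[where A = ?s and ks = "rev [1..<N - 1]", OF q s f] by (simp add: G_R_def g_def)
  then have "A_R_simple N q d d' f = phi q (op_scale (q powi (1 - int N) * D_prod N d d') (Lam N))
      (op_prod (map ?e [1..<N]) h)"
    by (simp add: A_R_simple_def h_def[symmetric] op_inverse_phi[OF q s g]
        op_prod_op_inverse_phi[where A = ?s, OF q s h] del: One_nat_def)
  also have "h = op_prod (map ?E (rev [0..<N - 1])) f"
  proof -
    \<comment> \<open>The parameters enter as scalars, and the same two of them occur on both
      sides.\<close>
    have adj: "x_hat N q d d' i \<circ> x_hat N q d d' (Suc i)
        = op_scale q (x_hat N q d d' (Suc i) \<circ> x_hat N q d d' i)"
      if "i < N - 2" for i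
    proof -
      have "Suc i < N - 1" "N > 0"
        using that by auto
      then show ?thesis
        unfolding x_hat_eq op_scale_comp_op_scale[OF degree_raising_twisted_var[OF \<open>N > 0\<close>]]
          twisted_var_adjacent[OF _ q0] op_scale_op_scale
        by (simp add: mult_ac twisted_var_adjacent[OF _ q0] op_scale_op_scale)
    qed
    have far: "x_hat N q d d' i \<circ> x_hat N q d d' j = x_hat N q d d' j \<circ> x_hat N q d d' i"
      if "i + 2 \<le> j" "j \<le> N - 2" for i j
    proof -
      have "j < N - 1" "N > 0"
        using that by auto
      then show ?thesis
        unfolding x_hat_eq op_scale_comp_op_scale[OF degree_raising_twisted_var[OF \<open>N > 0\<close>]]
        using twisted_var_commute[OF that(1)] by (simp add: mult_ac)
    qed
    have N1: "N - 2 + 1 = N - 1"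
      using N by simp
    have "op_prod (map (\<lambda>i. phi q (?s i)) (rev [1..<N - 1])) \<circ> ?e 0
        \<circ> op_prod (map ?e [1..<N - 1]) = op_prod (map ?E (rev [0..<N - 1]))"
      by (rule right_conjugation[where a = "x_hat N q d d'" and k = "N - 2" and n = "N - 2", unfolded N1,
            OF q x adj far order_refl])
    then show ?thesis
      unfolding h_def g_def G_R_def by (metis o_apply)
  qed
  also have "phi q (op_scale (q powi (1 - int N) * D_prod N d d') (Lam N))
      (op_prod (map ?e [1..<N]) \<dots>) = A_R_higher N q d d' f"
    by (simp add: A_R_higher_def)
  finally show ?thesis .
qed

theorem proposition2p3:
  fixes N :: nat and q :: complex and d d' :: "nat \<Rightarrow> complex"
  assumes "N \<ge> 2"
    and "0 < norm q" and "norm q < 1"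
    and "\<And>i. i < N \<Longrightarrow> d i \<noteq> 0" and "\<And>i. i < N \<Longrightarrow> d' i \<noteq> 0"
  shows "(\<forall>f\<in>power_series N. A_L_simple N q f = A_L_higher N q f) \<and>
         (\<forall>f\<in>power_series N. A_R_simple N q d d' f = A_R_higher N q d d' f)"
proof -
  have "q \<noteq> 0"
    using assms(2) by simp
  then show ?thesis
    using A_L_simple_eq_higher A_R_simple_eq_higher assms(1,3) by blast
qed

end
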